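(* Let $\Phi=(v_j)_{j\in J}$ and $\Psi=(w_j)_{j\in J}$ be finite sequences of vectors in Hilbert spaces (both real or both complex). Then: 1. $\Phi$ and $\Psi$ are unitarily equivalent if and only if their Gramians are equal, i.e. $\langle v_j,v_k\rangle=\langle w_j,w_k\rangle$ for all $j,k\in J$. 2. If the frame graphs of $\Phi$ and $\Psi$ are complete, then $\Phi$ and $\Psi$ are projectively unitarily equivalent if and only if their triple products are equal, i.e. $$\langle v_j,v_k\rangle\langle v_k,v_\ell\rangle\langle v_\ell,v_j\rangle=\langle w_j,w_k\rangle\langle w_k,w_\ell\rangle\langle w_\ell,w_j\rangle\qquad\text{for all } j,k,\ell\in J$$ (indices not necessarily distinct).
   Context: Inner products are linear in the first variable. Let $(v_j)$ and $(w_j)$ be finite sequences with the same index set, in inner product spaces over the same field ($\mathbb{R}$ or $\mathbb{C}$), and let $\mathcal{H}_1=\mathrm{span}\{v_j\}$, $\mathcal{H}_2=\mathrm{span}\{w_j\}$. They are unitarily equivalent if there is a unitary map (surjective linear isometry) $U:\mathcal{H}_1\to\mathcal{H}_2$ with $w_j=Uv_j$ for all $j$, and projectively unitarily equivalent if there are a unitary map $U:\mathcal{H}_1\to\mathcal{H}_2$ and scalars $c_j$ with $|c_j|=1$ such that $w_j=c_jUv_j$ for all $j$. The frame graph of $(v_j)_{j\in J}$ is the simple graph with vertex set $J$ and an edge between $j\ne k$ if and only if $\langle v_j,v_k\rangle\ne0$; it is complete if $\langle v_j,v_k\rangle\ne0$ for all $j\ne k$. *)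

theory Defs
  imports "HOL-Analysis.Analysis"
begin

text \<open>
  HOL-Analysis has real inner product spaces only. The class below is the complex counterpart of
  \<^class>\<open>real_inner\<close>, with the inner product linear in its first argument. The norm and metric of
  \<^class>\<open>real_normed_vector\<close> are tied to it by \<open>norm_eq_sqrt_cinner\<close>; the law
  \<open>scaleC 1 x = x\<close> is the case \<open>r = 1\<close> of \<open>scaleR_scaleC\<close>. A complex Hilbert space is a type of
  class \<open>{complex_inner, complete_space}\<close>, a real one of class \<open>{real_inner, complete_space}\<close>.
\<close>

class complex_inner = real_normed_vector +
  fixes scaleC :: "complex \<Rightarrow> 'a \<Rightarrow> 'a"
    and cinner :: "'a \<Rightarrow> 'a \<Rightarrow> complex"
  assumes scaleC_add_right: "scaleC c (x + y) = scaleC c x + scaleC c y"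
    and scaleC_add_left: "scaleC (c + d) x = scaleC c x + scaleC d x"
    and scaleC_scaleC: "scaleC c (scaleC d x) = scaleC (c * d) x"
    and scaleR_scaleC: "scaleR r x = scaleC (complex_of_real r) x"
    and cinner_commute: "cinner x y = cnj (cinner y x)"
    and cinner_add_left: "cinner (x + y) z = cinner x z + cinner y z"
    and cinner_scaleC_left: "cinner (scaleC c x) y = c * cinner x y"
    and cinner_ge_zero: "0 \<le> Re (cinner x x)"
    and cinner_eq_zero_iff: "cinner x x = 0 \<longleftrightarrow> x = 0"
    and norm_eq_sqrt_cinner: "norm x = sqrt (Re (cinner x x))"

instantiation complex :: complex_inner
begin

definition scaleC_complex :: "complex \<Rightarrow> complex \<Rightarrow> complex" where
  "scaleC_complex c x = c * x"

definition cinner_complex :: "complex \<Rightarrow> complex \<Rightarrow> complex" where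
  "cinner_complex x y = x * cnj y"

instance
proof
  fix x y z c d :: complex and r :: real
  show "scaleC c (x + y) = scaleC c x + scaleC c y"
    by (simp add: scaleC_complex_def distrib_left)
  show "scaleC (c + d) x = scaleC c x + scaleC d x"
    by (simp add: scaleC_complex_def distrib_right)
  show "scaleC c (scaleC d x) = scaleC (c * d) x"
    by (simp add: scaleC_complex_def mult.assoc)
  show "scaleR r x = scaleC (complex_of_real r) x"
    by (simp add: scaleC_complex_def scaleR_conv_of_real)
  show "cinner x y = cnj (cinner y x)"
    by (simp add: cinner_complex_def mult.commute)
  show "cinner (x + y) z = cinner x z + cinner y z"
    by (simp add: cinner_complex_def distrib_right)
  show "cinner (scaleC c x) y = c * cinner x y"
    by (simp add: cinner_complex_def scaleC_complex_def mult.assoc)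
  show "0 \<le> Re (cinner x x)"
    by (simp add: cinner_complex_def)
  show "cinner x x = 0 \<longleftrightarrow> x = 0"
    by (simp add: cinner_complex_def)
  show "norm x = sqrt (Re (cinner x x))"
    by (simp add: cinner_complex_def cmod_def power2_eq_square)
qed

end

instantiation vec :: (complex_inner, finite) complex_inner
begin

definition scaleC_vec :: "complex \<Rightarrow> 'a ^ 'b \<Rightarrow> 'a ^ 'b" where
  "scaleC_vec c x = (\<chi> i. scaleC c (x $ i))"

definition cinner_vec :: "'a ^ 'b \<Rightarrow> 'a ^ 'b \<Rightarrow> complex" where
  "cinner_vec x y = (\<Sum>i\<in>UNIV. cinner (x $ i) (y $ i))"

instance
proof
  fix x y z :: "'a ^ 'b" and c d :: complex and r :: real
  show "scaleC c (x + y) = scaleC c x + scaleC c y"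
    by (simp add: scaleC_vec_def vec_eq_iff scaleC_add_right)
  show "scaleC (c + d) x = scaleC c x + scaleC d x"
    by (simp add: scaleC_vec_def vec_eq_iff scaleC_add_left)
  show "scaleC c (scaleC d x) = scaleC (c * d) x"
    by (simp add: scaleC_vec_def vec_eq_iff scaleC_scaleC)
  show "scaleR r x = scaleC (complex_of_real r) x"
    by (simp add: scaleC_vec_def vec_eq_iff scaleR_scaleC)
  show "cinner x y = cnj (cinner y x)"
    unfolding cinner_vec_def cnj_sum by (intro sum.cong refl cinner_commute)
  show "cinner (x + y) z = cinner x z + cinner y z"
    by (simp add: cinner_vec_def cinner_add_left sum.distrib)
  show "cinner (scaleC c x) y = c * cinner x y"
    by (simp add: cinner_vec_def scaleC_vec_def cinner_scaleC_left sum_distrib_left)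
  show ge: "0 \<le> Re (cinner x x)"
    by (simp add: cinner_vec_def sum_nonneg cinner_ge_zero)
  have "(norm (x $ i))\<^sup>2 = Re (cinner (x $ i) (x $ i))" for i
    by (simp add: norm_eq_sqrt_cinner cinner_ge_zero)
  then show nrm: "norm x = sqrt (Re (cinner x x))"
    by (simp add: norm_vec_def L2_set_def cinner_vec_def)
  show "cinner x x = 0 \<longleftrightarrow> x = 0"
  proof
    assume "cinner x x = 0"
    then have "norm x = 0" by (simp add: nrm)
    then show "x = 0" by simp
  next
    assume "x = 0"
    then show "cinner x x = 0"
      by (simp add: cinner_vec_def cinner_eq_zero_iff)
  qed
qed

end

text \<open>
  The following notions are common to both fields: they take the scalar multiplications
  (\<open>scaleR\<close> or \<open>scaleC\<close>) and the inner product (\<open>inner\<close> or \<open>cinner\<close>) as arguments.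
  Since a map \<open>U\<close> in HOL is total, the conditions on it are relativised to the subspace \<open>S\<close>;
  its values outside \<open>S\<close> are irrelevant.
\<close>

definition unitary_map ::
  "('k::real_normed_field \<Rightarrow> 'a::real_normed_vector \<Rightarrow> 'a) \<Rightarrow>
   ('k \<Rightarrow> 'b::real_normed_vector \<Rightarrow> 'b) \<Rightarrow> 'a set \<Rightarrow> 'b set \<Rightarrow> ('a \<Rightarrow> 'b) \<Rightarrow> bool" where
  "unitary_map s1 s2 S T U \<longleftrightarrow>
     U ` S = T \<and>
     (\<forall>x\<in>S. \<forall>y\<in>S. U (x + y) = U x + U y) \<and>
     (\<forall>c. \<forall>x\<in>S. U (s1 c x) = s2 c (U x)) \<and>
     (\<forall>x\<in>S. norm (U x) = norm x)"

definition unitarily_equivalent ::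
  "('k::real_normed_field \<Rightarrow> 'a::real_normed_vector \<Rightarrow> 'a) \<Rightarrow>
   ('k \<Rightarrow> 'b::real_normed_vector \<Rightarrow> 'b) \<Rightarrow> 'i set \<Rightarrow> ('i \<Rightarrow> 'a) \<Rightarrow> ('i \<Rightarrow> 'b) \<Rightarrow> bool" where
  "unitarily_equivalent s1 s2 J v w \<longleftrightarrow>
     (\<exists>U. unitary_map s1 s2 (module.span s1 (v ` J)) (module.span s2 (w ` J)) U \<and>
          (\<forall>j\<in>J. w j = U (v j)))"

definition projectively_unitarily_equivalent ::
  "('k::real_normed_field \<Rightarrow> 'a::real_normed_vector \<Rightarrow> 'a) \<Rightarrow>
   ('k \<Rightarrow> 'b::real_normed_vector \<Rightarrow> 'b) \<Rightarrow> 'i set \<Rightarrow> ('i \<Rightarrow> 'a) \<Rightarrow> ('i \<Rightarrow> 'b) \<Rightarrow> bool" where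
  "projectively_unitarily_equivalent s1 s2 J v w \<longleftrightarrow>
     (\<exists>U c. unitary_map s1 s2 (module.span s1 (v ` J)) (module.span s2 (w ` J)) U \<and>
            (\<forall>j\<in>J. norm (c j) = 1 \<and> w j = s2 (c j) (U (v j))))"

text \<open>
  Adjacency in the frame graph; it is symmetric because the inner products are
  conjugate-symmetric.
\<close>

definition frame_graph_adj :: "('a \<Rightarrow> 'a \<Rightarrow> 'k::zero) \<Rightarrow> ('i \<Rightarrow> 'a) \<Rightarrow> 'i \<Rightarrow> 'i \<Rightarrow> bool" where
  "frame_graph_adj ip v j k \<longleftrightarrow> j \<noteq> k \<and> ip (v j) (v k) \<noteq> 0"

definition frame_graph_complete ::
  "('a \<Rightarrow> 'a \<Rightarrow> 'k::zero) \<Rightarrow> 'i set \<Rightarrow> ('i \<Rightarrow> 'a) \<Rightarrow> bool" where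
  "frame_graph_complete ip J v \<longleftrightarrow> (\<forall>j\<in>J. \<forall>k\<in>J. j \<noteq> k \<longrightarrow> frame_graph_adj ip v j k)"

definition triple_product ::
  "('a \<Rightarrow> 'a \<Rightarrow> 'k::times) \<Rightarrow> ('i \<Rightarrow> 'a) \<Rightarrow> 'i \<Rightarrow> 'i \<Rightarrow> 'i \<Rightarrow> 'k" where
  "triple_product ip v j k l = ip (v j) (v k) * ip (v k) (v l) * ip (v l) (v j)"

end

theory Submission
  imports Defs
begin

text \<open>
  A map with \<open>v\<^sub>j \<mapsto> w\<^sub>j\<close> is well defined and isometric on the span as soon as the Gramians agree,
  since the norm of \<open>\<Sum> a\<^sub>j v\<^sub>j\<close> depends only on the \<open>a\<^sub>j\<close> and the Gramian; the converse is
  polarization. For the triple products fix an index \<open>a\<close> with \<open>v\<^sub>a \<noteq> 0\<close>. The phases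
  \<open>c\<^sub>j = \<langle>w\<^sub>j, w\<^sub>a\<rangle> / \<langle>v\<^sub>j, v\<^sub>a\<rangle>\<close> are unimodular by the triple products \<open>(j, j, a)\<close>, and the triple
  products \<open>(j, k, a)\<close> show that the vectors \<open>c\<^sub>j\<^sup>-\<^sup>1 w\<^sub>j\<close> have the same Gramian as the \<open>v\<^sub>j\<close>.
\<close>

text \<open>Treats both fields at once: \<open>cj\<close> is the identity on the reals and \<^const>\<open>cnj\<close> on the complex numbers.\<close>

locale hermitian_space = vector_space s
  for s :: "'k::real_normed_field \<Rightarrow> 'a::real_normed_vector \<Rightarrow> 'a" +
  fixes cj :: "'k \<Rightarrow> 'k" and ip :: "'a \<Rightarrow> 'a \<Rightarrow> 'k"
  assumes cj_add: "cj (a + b) = cj a + cj b"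
    and cj_mult: "cj (a * b) = cj a * cj b"
    and cj_cj [simp]: "cj (cj a) = a"
    and mult_cj: "a * cj a = of_real ((norm a)\<^sup>2)"
    and ip_commute: "ip x y = cj (ip y x)"
    and ip_add_left: "ip (x + y) z = ip x z + ip y z"
    and ip_scale_left: "ip (s c x) y = c * ip x y"
    and ip_self: "ip x x = of_real ((norm x)\<^sup>2)"
begin

section \<open>Conjugation, sesquilinearity and spans in one space\<close>

lemma norm_cj [simp]: "norm (cj a) = norm a"
proof -
  have "norm b * norm (cj b) = norm b * norm b" for b
    using arg_cong[OF mult_cj[of b], of norm]
    by (simp add: norm_mult power2_eq_square)
  \<comment> \<open>The instance at \<open>a\<close> settles \<open>a \<noteq> 0\<close>; if
    \<open>a = 0\<close>, the instance at \<open>cj a\<close> forces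
    \<open>cj a = 0\<close>.\<close>
  from this[of a] this[of "cj a"] show ?thesis by auto
qed

lemma cj_eq_0_iff [simp]: "cj a = 0 \<longleftrightarrow> a = 0"
  by (metis norm_cj norm_eq_zero)

lemma mult_cj_unit: "norm c = 1 \<Longrightarrow> c * cj c = 1"
  by (simp add: mult_cj)

lemma cj_mult_unit: "norm c = 1 \<Longrightarrow> cj c * c = 1"
  by (simp add: mult_cj_unit mult.commute)

lemma ip_add_right: "ip x (y + z) = ip x y + ip x z"
  by (metis cj_add ip_add_left ip_commute)

lemma ip_scale_right: "ip x (s c y) = cj c * ip x y"
  by (metis cj_mult ip_commute ip_scale_left)

lemma ip_zero_left [simp]: "ip 0 y = 0"
  using ip_add_left[of 0 0 y] by simp

lemma ip_zero_right [simp]: "ip x 0 = 0"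
  using ip_add_right[of x 0 0] by simp

lemma ip_sum_left: "ip (\<Sum>j\<in>J. f j) y = (\<Sum>j\<in>J. ip (f j) y)"
  by (induction J rule: infinite_finite_induct) (simp_all add: ip_add_left)

lemma ip_sum_right: "ip y (\<Sum>j\<in>J. f j) = (\<Sum>j\<in>J. ip y (f j))"
  by (induction J rule: infinite_finite_induct) (simp_all add: ip_add_right)

text \<open>The vectors enter the expansion only through their Gramian, so equal Gramians give equal
  norms of combinations with the same coefficients.\<close>

lemma ip_combination:
  "ip (\<Sum>j\<in>J. s (a j) (v j)) (\<Sum>j\<in>J. s (b j) (v j))
    = (\<Sum>j\<in>J. \<Sum>k\<in>J. a j * (cj (b k) * ip (v j) (v k)))"
  unfolding ip_sum_left by (simp add: ip_sum_right ip_scale_left ip_scale_right sum_distrib_left mult_ac)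

lemma norm_eq_if_ip_self_eq:
  "(of_real ((norm x)\<^sup>2) :: 'k) = of_real ((norm y)\<^sup>2) \<Longrightarrow> norm x = norm y"
  by (simp only: of_real_eq_iff power2_eq_iff_nonneg norm_ge_zero)

text \<open>Coefficients belong to indices, not to vectors: repetitions in \<open>v\<close> are
  harmless, and one coefficient family serves two sequences at once.\<close>

lemma span_image_eq:
  assumes "finite J"
  shows "span (v ` J) = range (\<lambda>a. \<Sum>j\<in>J. s (a j) (v j))"
proof
  show "range (\<lambda>a. \<Sum>j\<in>J. s (a j) (v j)) \<subseteq> span (v ` J)"
    by (intro image_subsetI span_sum span_scale span_base imageI)
  show "span (v ` J) \<subseteq> range (\<lambda>a. \<Sum>j\<in>J. s (a j) (v j))"
  proof (rule span_minimal)
    show "v ` J \<subseteq> range (\<lambda>a. \<Sum>j\<in>J. s (a j) (v j))"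
    proof
      fix x assume "x \<in> v ` J"
      then obtain i where i: "i \<in> J" "x = v i" by blast
      have "(\<Sum>j\<in>J. s (if j = i then 1 else 0) (v j)) = (\<Sum>j\<in>J. if j = i then v j else 0)"
        by (intro sum.cong) auto
      also have "\<dots> = x" using i assms by simp
      finally show "x \<in> range (\<lambda>a. \<Sum>j\<in>J. s (a j) (v j))"
        by (intro range_eqI[where x = "\<lambda>j. if j = i then 1 else 0"]) (rule sym)
    qed
    show "subspace (range (\<lambda>a. \<Sum>j\<in>J. s (a j) (v j)))"
    proof (rule subspaceI)
      show "0 \<in> range (\<lambda>a. \<Sum>j\<in>J. s (a j) (v j))"
        by (rule range_eqI[where x = "\<lambda>_. 0"]) simp
    next
      fix x y assume "x \<in> range (\<lambda>a. \<Sum>j\<in>J. s (a j) (v j))" "y \<in> range (\<lambda>a. \<Sum>j\<in>J. s (a j) (v j))"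
      then obtain a b where "x = (\<Sum>j\<in>J. s (a j) (v j))" "y = (\<Sum>j\<in>J. s (b j) (v j))" by blast
      then have "x + y = (\<Sum>j\<in>J. s (a j + b j) (v j))"
        by (simp add: scale_left_distrib sum.distrib)
      then show "x + y \<in> range (\<lambda>a. \<Sum>j\<in>J. s (a j) (v j))"
        by (intro range_eqI[where x = "\<lambda>j. a j + b j"])
    next
      fix c x assume "x \<in> range (\<lambda>a. \<Sum>j\<in>J. s (a j) (v j))"
      then obtain a where "x = (\<Sum>j\<in>J. s (a j) (v j))" by blast
      then have "s c x = (\<Sum>j\<in>J. s (c * a j) (v j))"
        by (simp add: scale_sum_right)
      then show "s c x \<in> range (\<lambda>a. \<Sum>j\<in>J. s (a j) (v j))"
        by (intro range_eqI[where x = "\<lambda>j. c * a j"])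
    qed
  qed
qed

lemma span_image_scale_subset: "span ((\<lambda>j. s (c j) (w j)) ` J) \<subseteq> span (w ` J)"
  by (rule span_minimal) (auto intro: span_scale span_base)

text \<open>Scaling by \<open>cj (c j)\<close> undoes scaling by \<open>c j\<close>, so each family
  is a rescaling of the other.\<close>

lemma span_image_scale_unit:
  assumes "\<And>j. j \<in> J \<Longrightarrow> norm (c j) = 1"
  shows "span ((\<lambda>j. s (c j) (w j)) ` J) = span (w ` J)"
proof
  have "w ` J = (\<lambda>j. s (cj (c j)) (s (c j) (w j))) ` J"
    using assms by (intro image_cong) (simp_all add: cj_mult_unit)
  then show "span (w ` J) \<subseteq> span ((\<lambda>j. s (c j) (w j)) ` J)"
    by (metis span_image_scale_subset)
qed (rule span_image_scale_subset)

end

section \<open>Unitary maps between two spaces and the Gramian criterion\<close>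

locale hermitian_pair = V: hermitian_space s1 cj ip1 + W: hermitian_space s2 cj ip2
  for s1 :: "'k::real_normed_field \<Rightarrow> 'a::real_normed_vector \<Rightarrow> 'a" and cj ip1
    and s2 :: "'k \<Rightarrow> 'b::real_normed_vector \<Rightarrow> 'b" and ip2
begin

text \<open>Polarization uniform in the field: norms of sums determine \<open>a + cj a\<close> for
  each inner product \<open>a\<close>, and testing this with \<open>x\<close> scaled by the
  conjugate of the defect \<open>d\<close> shows that \<open>d\<close> vanishes.\<close>

lemma unitary_map_preserves_ip:
  assumes U: "unitary_map s1 s2 S T U" and S: "V.subspace S" and "x \<in> S" "y \<in> S"
  shows "ip2 (U x) (U y) = ip1 x y"
proof -
  have self: "ip2 (U z) (U z) = ip1 z z" if "z \<in> S" for z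
    using U that by (simp add: V.ip_self W.ip_self unitary_map_def)
  have add: "U (z + z') = U z + U z'" if "z \<in> S" "z' \<in> S" for z z'
    using U that by (simp add: unitary_map_def)
  have scale: "U (s1 c z) = s2 c (U z)" if "z \<in> S" for c z
    using U that by (simp add: unitary_map_def)
  have re: "ip2 (U z) (U y) + cj (ip2 (U z) (U y)) = ip1 z y + cj (ip1 z y)" if "z \<in> S" for z
    using self[of "z + y"] self[OF that] self[OF \<open>y \<in> S\<close>] add[OF that \<open>y \<in> S\<close>]
      V.subspace_add[OF S that \<open>y \<in> S\<close>]
      V.ip_commute[of y z] W.ip_commute[of "U y" "U z"]
    by (simp add: V.ip_add_left V.ip_add_right W.ip_add_left W.ip_add_right add_ac)
  define d where "d = ip2 (U x) (U y) - ip1 x y"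
  have cj_diff: "cj (a - b) = cj a - cj b" for a b
    using V.cj_add[of "a - b" b] by (simp add: algebra_simps)
  \<comment> \<open>the real part of \<open>cj d * d\<close> vanishes, and this number is \<open>|d|\<^sup>2\<close>\<close>
  have "cj d * ip2 (U x) (U y) + cj (cj d * ip2 (U x) (U y))
      = cj d * ip1 x y + cj (cj d * ip1 x y)"
    using re[OF V.subspace_scale[OF S \<open>x \<in> S\<close>, of "cj d"]]
    by (simp only: scale[OF \<open>x \<in> S\<close>] V.ip_scale_left W.ip_scale_left)
  \<comment> \<open>The scalar \<open>cj d\<close> stays folded; only the plain factors
    \<open>d\<close> are expanded.\<close>
  then have "cj d * d + cj (cj d * d) = 0"
    by (subst (2 4) d_def) (simp only: right_diff_distrib cj_diff, simp add: algebra_simps)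
  then have "2 * (d * cj d) = 0"
    by (simp add: V.cj_mult mult.commute)
  then have "d = 0" by simp
  then show ?thesis by (simp add: d_def)
qed

lemma unitarily_equivalent_iff_gram_eq:
  assumes "finite J"
  shows "unitarily_equivalent s1 s2 J v w \<longleftrightarrow> (\<forall>j\<in>J. \<forall>k\<in>J. ip1 (v j) (v k) = ip2 (w j) (w k))"
proof
  assume "unitarily_equivalent s1 s2 J v w"
  then obtain U where U: "unitary_map s1 s2 (V.span (v ` J)) (W.span (w ` J)) U"
    and w: "\<And>j. j \<in> J \<Longrightarrow> w j = U (v j)"
    unfolding unitarily_equivalent_def by blast
  show "\<forall>j\<in>J. \<forall>k\<in>J. ip1 (v j) (v k) = ip2 (w j) (w k)"
    using unitary_map_preserves_ip[OF U V.subspace_span] by (simp add: w V.span_base)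
next
  assume gram: "\<forall>j\<in>J. \<forall>k\<in>J. ip1 (v j) (v k) = ip2 (w j) (w k)"
  define A where "A = (\<lambda>a. \<Sum>j\<in>J. s1 (a j) (v j))"
  define B where "B = (\<lambda>a. \<Sum>j\<in>J. s2 (a j) (w j))"
  \<comment> \<open>\<open>U\<close> reads off some coefficient family of \<open>x\<close> and
    reuses it on the \<open>w\<close> side; \<open>U_A\<close> shows that the choice does not matter
    on the span.\<close>
  define U where "U = (\<lambda>x. B (SOME a. A a = x))"
  have norm_eq: "norm (A a) = norm (B a)" for a
  proof (rule V.norm_eq_if_ip_self_eq)
    show "(of_real ((norm (A a))\<^sup>2) :: 'k) = of_real ((norm (B a))\<^sup>2)"
      unfolding V.ip_self[symmetric] W.ip_self[symmetric] A_def B_def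
        V.ip_combination W.ip_combination
      by (intro sum.cong refl) (simp add: gram)
  qed
  have A_add: "A a + A b = A (\<lambda>j. a j + b j)" and B_add: "B a + B b = B (\<lambda>j. a j + b j)"
    and A_scale: "s1 c (A a) = A (\<lambda>j. c * a j)" and B_scale: "s2 c (B a) = B (\<lambda>j. c * a j)"
    for a b c
    by (simp_all add: A_def B_def V.scale_left_distrib W.scale_left_distrib sum.distrib
        V.scale_sum_right W.scale_sum_right)
  have A_diff: "A a - A b = A (\<lambda>j. a j - b j)" and B_diff: "B a - B b = B (\<lambda>j. a j - b j)" for a b
    by (simp_all add: A_def B_def V.scale_left_diff_distrib W.scale_left_diff_distrib
        sum_subtractf)
  have U_A: "U (A a) = B a" for a
  proof -
    \<comment> \<open>Two families with the same image under \<open>A\<close> differ by one that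
      \<open>A\<close> kills; \<open>norm_eq\<close> makes \<open>B\<close> kill it too.\<close>
    have "A (SOME b. A b = A a) = A a" by (rule someI[of _ a]) (rule refl)
    then have "norm (B (SOME b. A b = A a) - B a) = 0"
      by (simp only: B_diff norm_eq[symmetric] A_diff[symmetric]) simp
    then show ?thesis by (simp add: U_def)
  qed
  have spanV: "V.span (v ` J) = range A" and spanW: "W.span (w ` J) = range B"
    by (simp_all add: A_def B_def V.span_image_eq W.span_image_eq assms)
  have "unitary_map s1 s2 (V.span (v ` J)) (W.span (w ` J)) U"
    unfolding unitary_map_def spanV spanW
    by (auto simp: A_add A_scale U_A B_add B_scale norm_eq image_image)
  moreover have "w j = U (v j)" if "j \<in> J" for j
  proof -
    have "A (\<lambda>k. if k = j then 1 else 0) = (\<Sum>k\<in>J. if k = j then v k else 0)"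
      "B (\<lambda>k. if k = j then 1 else 0) = (\<Sum>k\<in>J. if k = j then w k else 0)"
      unfolding A_def B_def by (auto intro: sum.cong)
    then show ?thesis using U_A[of "\<lambda>k. if k = j then 1 else 0"] that assms by simp
  qed
  ultimately show "unitarily_equivalent s1 s2 J v w"
    unfolding unitarily_equivalent_def by blast
qed

section \<open>Phases and triple products\<close>

lemma projectively_unitarily_equivalent_if_phases:
  assumes "finite J" and c: "\<And>j. j \<in> J \<Longrightarrow> norm (c j) = 1"
    and gram: "\<And>j k. j \<in> J \<Longrightarrow> k \<in> J \<Longrightarrow> ip2 (w j) (w k) = c j * cj (c k) * ip1 (v j) (v k)"
  shows "projectively_unitarily_equivalent s1 s2 J v w"
proof -
  \<comment> \<open>For unimodular \<open>c j\<close> the conjugate is the inverse, so this strips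
    the phases from \<open>w\<close> and reduces the claim to the Gramian criterion.\<close>
  define w' where "w' = (\<lambda>j. s2 (cj (c j)) (w j))"
  have "ip1 (v j) (v k) = ip2 (w' j) (w' k)" if "j \<in> J" "k \<in> J" for j k
  proof -
    have "ip2 (w' j) (w' k) = (cj (c j) * c j) * (cj (c k) * c k) * ip1 (v j) (v k)"
      by (simp add: w'_def W.ip_scale_left W.ip_scale_right gram that)
    then show ?thesis by (simp add: V.cj_mult_unit c that)
  qed
  then have "unitarily_equivalent s1 s2 J v w'"
    using unitarily_equivalent_iff_gram_eq[OF \<open>finite J\<close>] by blast
  then obtain U where U: "unitary_map s1 s2 (V.span (v ` J)) (W.span (w' ` J)) U"
    and w': "\<And>j. j \<in> J \<Longrightarrow> w' j = U (v j)"
    unfolding unitarily_equivalent_def by blast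
  have "W.span (w' ` J) = W.span (w ` J)"
    unfolding w'_def by (rule W.span_image_scale_unit) (simp add: c)
  moreover have "w j = s2 (c j) (U (v j))" if "j \<in> J" for j
    using c[OF that] by (simp add: w'[OF that, symmetric] w'_def V.mult_cj_unit)
  ultimately show ?thesis
    using U c unfolding projectively_unitarily_equivalent_def by metis
qed

text \<open>Each of the three indices stands once in a first slot and once in a second slot, so
  every phase meets its conjugate and cancels.\<close>

lemma triple_product_eq_if_projectively_unitarily_equivalent:
  assumes "projectively_unitarily_equivalent s1 s2 J v w" and J: "j \<in> J" "k \<in> J" "l \<in> J"
  shows "triple_product ip1 v j k l = triple_product ip2 w j k l"
proof -
  obtain U c where U: "unitary_map s1 s2 (V.span (v ` J)) (W.span (w ` J)) U"
    and c: "\<And>j. j \<in> J \<Longrightarrow> norm (c j) = 1"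
    and w: "\<And>j. j \<in> J \<Longrightarrow> w j = s2 (c j) (U (v j))"
    using assms(1) unfolding projectively_unitarily_equivalent_def by blast
  have ip: "ip2 (w i) (w m) = c i * cj (c m) * ip1 (v i) (v m)" if "i \<in> J" "m \<in> J" for i m
    using unitary_map_preserves_ip[OF U V.subspace_span] that
    by (simp add: w W.ip_scale_left W.ip_scale_right V.span_base)
  have "triple_product ip2 w j k l
      = (c j * cj (c j)) * (c k * cj (c k)) * (c l * cj (c l)) * triple_product ip1 v j k l"
    by (simp add: triple_product_def ip J)
  then show ?thesis by (simp add: V.mult_cj_unit c J)
qed

lemma projectively_unitarily_equivalent_if_triple_product_eq:
  assumes "finite J" and complete: "frame_graph_complete ip1 J v"
    and triple: "\<And>j k l. j \<in> J \<Longrightarrow> k \<in> J \<Longrightarrow> l \<in> J \<Longrightarrow>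
      triple_product ip1 v j k l = triple_product ip2 w j k l"
  shows "projectively_unitarily_equivalent s1 s2 J v w"
proof -
  have norm_eq: "norm (v j) = norm (w j)" if "j \<in> J" for j
  proof -
    have "norm (triple_product ip1 v j j j) = norm (triple_product ip2 w j j j)"
      using triple that by simp
    \<comment> \<open>The diagonal triple product \<open>(j, j, j)\<close> is the sixth power of the
      norm.\<close>
    then have "norm (v j) ^ 6 = norm (w j) ^ 6"
      by (simp add: triple_product_def V.ip_self W.ip_self norm_mult norm_power
          flip: power_add)
    then show ?thesis by (rule power_eq_imp_eq_base) simp_all
  qed
  show ?thesis
  proof (cases "\<exists>a\<in>J. v a \<noteq> 0")
    \<comment> \<open>Both sequences vanish on \<open>J\<close>, and trivial phases suffice.\<close>
    case False
    then have "v j = 0 \<and> w j = 0" if "j \<in> J" for j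
      using norm_eq that by fastforce
    then show ?thesis
      using \<open>finite J\<close>
      by (intro projectively_unitarily_equivalent_if_phases[where c = "\<lambda>_. 1"]) simp_all
  next
    case True
    then obtain a where a: "a \<in> J" "v a \<noteq> 0" by blast
    \<comment> \<open>Completeness covers \<open>j \<noteq> a\<close>, and
      \<open>v a \<noteq> 0\<close> covers \<open>j = a\<close>.\<close>
    have nz: "ip1 (v j) (v a) \<noteq> 0" if "j \<in> J" for j
      using complete a that
      by (cases "j = a") (auto simp: V.ip_self frame_graph_complete_def frame_graph_adj_def)
    define c where "c = (\<lambda>j. ip2 (w j) (w a) / ip1 (v j) (v a))"
    have w_a: "ip2 (w j) (w a) = c j * ip1 (v j) (v a)" if "j \<in> J" for j
      using nz that by (simp add: c_def)
    have a_w: "ip2 (w a) (w j) = cj (c j) * ip1 (v a) (v j)" if "j \<in> J" for j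
      using w_a[OF that] by (metis V.cj_mult V.ip_commute W.ip_commute)
    have nz': "ip1 (v a) (v j) \<noteq> 0" if "j \<in> J" for j
      using nz[OF that] V.ip_commute[of "v a" "v j"] by simp
    have c_cj: "c j * cj (c j) = 1" if "j \<in> J" for j
    proof -
      \<comment> \<open>\<open>nz\<close> forces \<open>v j \<noteq> 0\<close>, so the common factor
        \<open>ip1 (v j) (v j)\<close> can be cancelled from the triple products
        \<open>(j, j, a)\<close>.\<close>
      have "ip1 (v j) (v j) \<noteq> 0" using nz[OF that] by (auto simp: V.ip_self)
      moreover have "ip1 (v j) (v j) = ip2 (w j) (w j)"
        by (simp add: V.ip_self W.ip_self norm_eq that)
      moreover have "ip1 (v j) (v j) * ip1 (v j) (v a) * ip1 (v a) (v j)
          = ip2 (w j) (w j) * ip2 (w j) (w a) * ip2 (w a) (w j)"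
        using triple[OF that that a(1)] by (simp add: triple_product_def)
      ultimately have "ip1 (v j) (v a) * ip1 (v a) (v j)
          = (c j * cj (c j)) * (ip1 (v j) (v a) * ip1 (v a) (v j))"
        by (simp add: w_a a_w that mult_ac)
      then show ?thesis using nz nz' that by simp
    qed
    have c: "norm (c j) = 1" if "j \<in> J" for j
    proof -
      have "norm (c j) * norm (c j) = 1"
        using arg_cong[OF c_cj[OF that], of norm] by (simp add: norm_mult)
      then show ?thesis by (simp add: power2_eq_1_iff flip: power2_eq_square)
          (use norm_ge_zero[of "c j"] in linarith)
    qed
    show ?thesis
    proof (rule projectively_unitarily_equivalent_if_phases[OF \<open>finite J\<close> c])
      fix j k assume jk: "j \<in> J" "k \<in> J"
      have "ip1 (v j) (v k) * ip1 (v k) (v a) * ip1 (v a) (v j)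
          = ip2 (w j) (w k) * (c k * ip1 (v k) (v a)) * (cj (c j) * ip1 (v a) (v j))"
        using triple[OF jk a(1)] by (simp add: triple_product_def w_a a_w jk)
      \<comment> \<open>The two nonzero factors involving \<open>v a\<close> cancel; multiplying by
        \<open>c j * cj (c k)\<close> then moves the phases to the other side.\<close>
      then have "ip1 (v j) (v k) = ip2 (w j) (w k) * c k * cj (c j)"
        using nz[OF jk(2)] nz'[OF jk(1)] by simp
      then have "c j * cj (c k) * ip1 (v j) (v k)
          = (c j * cj (c j)) * (c k * cj (c k)) * ip2 (w j) (w k)"
        by (simp add: mult_ac)
      then show "ip2 (w j) (w k) = c j * cj (c k) * ip1 (v j) (v k)"
        by (simp add: c_cj jk)
    qed
  qed
qed

lemma projectively_unitarily_equivalent_iff_triple_product_eq: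
  assumes "finite J" and "frame_graph_complete ip1 J v"
  shows "projectively_unitarily_equivalent s1 s2 J v w \<longleftrightarrow>
    (\<forall>j\<in>J. \<forall>k\<in>J. \<forall>l\<in>J. triple_product ip1 v j k l = triple_product ip2 w j k l)"
proof
  assume "projectively_unitarily_equivalent s1 s2 J v w"
  then show "\<forall>j\<in>J. \<forall>k\<in>J. \<forall>l\<in>J. triple_product ip1 v j k l = triple_product ip2 w j k l"
    by (intro ballI triple_product_eq_if_projectively_unitarily_equivalent)
next
  assume "\<forall>j\<in>J. \<forall>k\<in>J. \<forall>l\<in>J. triple_product ip1 v j k l = triple_product ip2 w j k l"
  then show "projectively_unitarily_equivalent s1 s2 J v w"
    by (intro projectively_unitarily_equivalent_if_triple_product_eq[OF assms]) simp
qed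

end

section \<open>The real and complex instances\<close>

lemma hermitian_space_real:
  "hermitian_space scaleR id (inner :: 'a::real_inner \<Rightarrow> 'a \<Rightarrow> real)"
  by unfold_locales
    (simp_all add: scaleR_right_distrib scaleR_left_distrib power2_eq_square inner_commute
      inner_add_left inner_add_right flip: power2_norm_eq_inner)

lemma hermitian_space_complex:
  "hermitian_space scaleC cnj (cinner :: 'a::complex_inner \<Rightarrow> 'a \<Rightarrow> complex)"
proof unfold_locales
  fix x y z :: 'a and c d :: complex
  show "scaleC 1 x = x" using scaleR_scaleC[of 1 x] by simp
  show "c * cnj c = of_real ((norm c)\<^sup>2)" by (simp only: complex_norm_square)
  show "cinner x y = cnj (cinner y x)" by (rule cinner_commute)
  \<comment> \<open>The norm axiom concerns only the real part of \<open>cinner x x\<close>;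
    conjugate symmetry removes the imaginary part.\<close>
  have "Im (cinner x x) = 0"
    using arg_cong[OF cinner_commute[of x x], of Im] by simp
  then show "cinner x x = of_real ((norm x)\<^sup>2)"
    by (simp add: norm_eq_sqrt_cinner cinner_ge_zero complex_eq_iff)
qed (simp_all add: scaleC_add_right scaleC_add_left scaleC_scaleC cinner_add_left
    cinner_scaleC_left)

theorem theorem2p2:
  fixes J :: "'i set"
    and v :: "'i \<Rightarrow> 'a::{real_inner, complete_space}"
    and w :: "'i \<Rightarrow> 'b::{real_inner, complete_space}"
    and x :: "'i \<Rightarrow> 'c::{complex_inner, complete_space}"
    and y :: "'i \<Rightarrow> 'd::{complex_inner, complete_space}"
  assumes "finite J"
  shows
    "((unitarily_equivalent scaleR scaleR J v w \<longleftrightarrow>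
        (\<forall>j\<in>J. \<forall>k\<in>J. inner (v j) (v k) = inner (w j) (w k))) \<and>
      (frame_graph_complete inner J v \<and> frame_graph_complete inner J w \<longrightarrow>
        (projectively_unitarily_equivalent scaleR scaleR J v w \<longleftrightarrow>
          (\<forall>j\<in>J. \<forall>k\<in>J. \<forall>l\<in>J. triple_product inner v j k l = triple_product inner w j k l)))) \<and>
     ((unitarily_equivalent scaleC scaleC J x y \<longleftrightarrow>
        (\<forall>j\<in>J. \<forall>k\<in>J. cinner (x j) (x k) = cinner (y j) (y k))) \<and>
      (frame_graph_complete cinner J x \<and> frame_graph_complete cinner J y \<longrightarrow>
        (projectively_unitarily_equivalent scaleC scaleC J x y \<longleftrightarrow>
          (\<forall>j\<in>J. \<forall>k\<in>J. \<forall>l\<in>J. triple_product cinner x j k l = triple_product cinner y j k l))))"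
proof -
  interpret R: hermitian_pair scaleR id "inner :: 'a \<Rightarrow> _" scaleR "inner :: 'b \<Rightarrow> _"
    by (intro hermitian_pair.intro hermitian_space_real)
  interpret C: hermitian_pair scaleC cnj "cinner :: 'c \<Rightarrow> _" scaleC "cinner :: 'd \<Rightarrow> _"
    by (intro hermitian_pair.intro hermitian_space_complex)
  show ?thesis
    using R.unitarily_equivalent_iff_gram_eq[OF assms, of v w]
      R.projectively_unitarily_equivalent_iff_triple_product_eq[OF assms, of v w]
      C.unitarily_equivalent_iff_gram_eq[OF assms, of x y]
      C.projectively_unitarily_equivalent_iff_triple_product_eq[OF assms, of x y]
    by blast
qed

end
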